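(* Let $R:=\{(\lambda,\mu)\in(0,\tfrac13)^2 : \tau(C^2_\lambda)\cdot\tau(C^2_\mu)<1\}$. For all $m,n\in\mathbb{N}$ with $m\ne n$ there exists a nondegenerate interval $I_{m,n}\subset(1,\infty)$ such that the smooth curve $$r_{m,n}: I_{m,n}\to R,\qquad r_{m,n}(\gamma)=(\gamma^{-n},\gamma^{-m}),$$ is well defined (i.e. takes values in $R$), and for every $\gamma\in I_{m,n}$ the set $\mathcal{IP}_{r_{m,n}(\gamma)}$ contains an open interval around $\frac{\pi}{4}$.
   Context: $\mathbb{N}=\{1,2,3,\dots\}$. For a natural number $M$ and $0<\lambda<\frac1{M+1}$, the $M$-middle Cantor set is $$C_\lambda^M:=\Big\{\tfrac{1-\lambda}{M}\sum_{k=0}^{\infty}a_k\lambda^k : a_k\in\{0,1,\dots,M\}\Big\}\subset[0,1],$$ and $C_\lambda:=C_\lambda^1$ is the middle-$(1-2\lambda)$ Cantor set. The Newhouse thickness of $C_\lambda^M$ is $\tau(C_\lambda^M)=\frac{M\lambda}{1-(M+1)\lambda}$; in particular $\tau(C^2_\lambda)=\frac{2\lambda}{1-3\lambda}$ for $0<\lambda<\frac13$. For a nonempty set $E\subset\mathbb{R}^2$, $\mathcal{IP}(E)$ is the set of all $\theta\in[0,\pi)$ such that the projection of the plane along lines making angle $\theta$ with the positive $x$-axis (for $\theta\neq0$: $\pi_\theta(x,y)=x-y\cot\theta$) is not one-to-one on $E$; equivalently, the set of all directions $\theta\in[0,\pi)$ of lines joining two distinct points of $E$. For $(\lambda,\mu)$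 with $0<\lambda,\mu<\frac12$, $\mathcal{IP}_{(\lambda,\mu)}:=\mathcal{IP}(C_\lambda\times C_\mu)$. *)

theory Defs
  imports "HOL-Analysis.Analysis"
begin

(* Meaningful for M >= 1 and 0 < l < 1 / (M + 1). *)
definition middle_cantor :: "nat \<Rightarrow> real \<Rightarrow> real set" where
  "middle_cantor M l =
     {(1 - l) / real M * (\<Sum>k. real (a k) * l ^ k) | a :: nat \<Rightarrow> nat. \<forall>k. a k \<in> {0..M}}"

(* The projection along lines making angle t with the positive x-axis; since cot 0 = 0 in
   the library, the horizontal direction needs its own case. *)
definition proj :: "real \<Rightarrow> real \<times> real \<Rightarrow> real" where
  "proj t p = (if t = 0 then snd p else fst p - snd p * cot t)"

definition IP :: "(real \<times> real) set \<Rightarrow> real set" where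
  "IP E = {t \<in> {0..<pi}. \<not> inj_on (proj t) E}"

definition IP_cantor :: "real \<times> real \<Rightarrow> real set" where
  "IP_cantor p = IP (middle_cantor 1 (fst p) \<times> middle_cantor 1 (snd p))"

(* Newhouse thickness of a compact K, following Palis and Takens. The gaps of K are the
   components of its complement. Lengths are Lebesgue measures in ennreal, so that the two
   unbounded gaps have infinite length. *)

definition bounded_gap :: "real set \<Rightarrow> real set \<Rightarrow> bool" where
  "bounded_gap K U \<longleftrightarrow> U \<in> components (- K) \<and> bounded U"

(* Intervals with boundary point u that meet no gap at least as long as U.
   As U itself is such a gap, they lie on the other side of u. *)
definition bridge_candidate :: "real set \<Rightarrow> real set \<Rightarrow> real \<Rightarrow> real set \<Rightarrow> bool" where
  "bridge_candidate K U u C \<longleftrightarrow>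
     is_interval C \<and> u \<in> frontier C \<and>
     (\<forall>V \<in> components (- K). emeasure lborel U \<le> emeasure lborel V \<longrightarrow> C \<inter> V = {})"

definition bridge :: "real set \<Rightarrow> real set \<Rightarrow> real \<Rightarrow> real set \<Rightarrow> bool" where
  "bridge K U u C \<longleftrightarrow>
     bridge_candidate K U u C \<and> (\<forall>D. bridge_candidate K U u D \<and> C \<subseteq> D \<longrightarrow> D = C)"

(* The infimum is infinite if K has no bounded gap. *)
definition thickness :: "real set \<Rightarrow> ennreal" where
  "thickness K =
     Inf {emeasure lborel C / emeasure lborel U | U u C.
            bounded_gap K U \<and> u \<in> frontier U \<and> bridge K U u C}"

definition region_R :: "(real \<times> real) set" where
  "region_R = {(l, k). l \<in> {0<..<1/3} \<and> k \<in> {0<..<1/3} \<and>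
     thickness (middle_cantor 2 l) * thickness (middle_cantor 2 k) < 1}"

definition r_curve :: "nat \<Rightarrow> nat \<Rightarrow> real \<Rightarrow> real \<times> real" where
  "r_curve m n g = (g powi (- int n), g powi (- int m))"

(* C-infinity on I; D k is the k-th derivative, one-sided at endpoints belonging to I. *)
definition smooth_curve_on :: "real set \<Rightarrow> (real \<Rightarrow> 'a::real_normed_vector) \<Rightarrow> bool" where
  "smooth_curve_on I f \<longleftrightarrow>
     (\<exists>D :: nat \<Rightarrow> real \<Rightarrow> 'a. (\<forall>t\<in>I. D 0 t = f t) \<and>
        (\<forall>k. \<forall>t\<in>I. (D k has_vector_derivative D (Suc k) t) (at t within I)))"

end

theory Submission
  imports Defs "HOL-Computational_Algebra.Fundamental_Theorem_Algebra"
begin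

text \<open>
Write \<open>l = \<gamma> powi (- n)\<close> and \<open>k = \<gamma> powi (- m)\<close>. A direction \<open>t\<close> joins two distinct points of
\<open>C\<^sub>l \<times> C\<^sub>k\<close> as soon as some nonzero \<open>u \<in> D\<^sub>l\<close> equals \<open>cot t \<cdot> v\<close> with \<open>v \<in> D\<^sub>k\<close>, where
\<open>D\<^sub>l = C\<^sub>l - C\<^sub>l\<close> is the Cantor set with three digits, stretched to the hull \<open>[-1, 1]\<close>. So two self-similar sets with
three pieces each have to be intersected, one of them scaled by \<open>cot t\<close>, which is close to 1.

The intersection is found as in Newhouse's gap lemma. Two overlapping pieces, with hulls of half-lengths
\<open>s\<close> and \<open>t\<close>, are kept so that neither hull fits into a gap of the other piece; then one of
them is replaced by a subpiece that still overlaps the other. Replacing the first piece preserves the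
invariant if \<open>s/t \<ge> (1 - 3k)/(2l)\<close>, replacing the second one if \<open>s/t \<le> 2k/(1 - 3l)\<close>. If the product
of the thicknesses is at least 1, one of the two inequalities always holds. If it is slightly smaller, the
process can fail only for ratios in a short interval from \<open>2k/(1 - 3l)\<close> to \<open>(1 - 3k)/(2l)\<close>. Along the curve,
however, all ratios that ever occur have the form \<open>\<gamma>\<^sup>i / cot t\<close> with \<open>i\<close> an integer, because \<open>l\<close> and \<open>k\<close> are
powers of the same number. For \<open>cot t\<close> close to 1, these numbers avoid the short interval near any parameter
at which the interval shrinks to a point that is not an integral power of \<open>\<gamma>\<close>.

Hence let \<open>\<gamma>\<^sub>0\<close> be the parameter at which \<open>4lk = (1 - 3l)(1 - 3k)\<close>, that is, at which the product of the
thicknesses is 1 (\<open>critical_parameter\<close>). The theorem follows by continuity on a short interval to the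
right of \<open>\<gamma>\<^sub>0\<close>, provided that \<open>2k/(1 - 3l)\<close> is not an integral power of \<open>\<gamma>\<^sub>0\<close>
(\<open>no_critical_resonance\<close>). This arithmetic fact is the heart of the proof. For \<open>x = 1/\<gamma>\<^sub>0\<close>, a resonance
gives, up to exchanging \<open>m\<close> and \<open>n\<close>, the two equations
\<open>2x\<^sup>a + 3x\<^sup>m = 1\<close> and \<open>x\<^sup>j (3x\<^sup>a + 2x\<^sup>m) = 1\<close>. A combination of them is monic up to sign, so \<open>x\<close> is an
algebraic integer; the first equation makes it a unit. But every common complex root of the two
equations has modulus at most 1, whereas \<open>0 < x < 1\<close>; so the norm of \<open>x\<close> has absolute value less than 1,
which is impossible for a unit.

Membership in the region needs only an upper bound for the thickness, and a single bridge provides it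
(\<open>thickness_ternary_cantor_le\<close>).
\<close>

section \<open>Units among the algebraic integers\<close>

abbreviation ieval :: "int poly \<Rightarrow> complex \<Rightarrow> complex" where
  "ieval p z \<equiv> poly (map_poly of_int p) z"

lemma ieval_add: "ieval (p + q) z = ieval p z + ieval q z"
proof -
  have "map_poly of_int (p + q) = (map_poly of_int p + map_poly of_int q :: complex poly)"
    by (intro poly_eqI) (simp add: coeff_map_poly)
  then show ?thesis by simp
qed

lemma ieval_smult: "ieval (smult c p) z = of_int c * ieval p z"
  by (simp add: map_poly_smult)

lemma ieval_minus: "ieval (p - q) z = ieval p z - ieval q z"
  using ieval_add[of "p - q" q z] by simp

lemma ieval_monom: "ieval (monom c k) z = of_int c * z ^ k"
  by (simp add: map_poly_monom poly_monom)

lemma ieval_mult: "ieval (p * q) z = ieval p z * ieval q z"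
  by (induction p) (simp_all add: ieval_add ieval_smult map_poly_pCons algebra_simps)

text \<open>
Division with remainder by an integer polynomial of least degree with root \<open>x\<close> is possible after
multiplying by a constant; by Gauss's lemma on contents, that constant cancels if the divisor is primitive.
\<close>

lemma primitive_minimal_divisor:
  fixes g :: "int poly"
  assumes "g \<noteq> 0" and "ieval g x = 0"
  obtains f where "f \<noteq> 0" and "ieval f x = 0" and "\<And>h. ieval h x = 0 \<Longrightarrow> f dvd h"
proof -
  define f0 where "f0 = (ARG_MIN degree p. p \<noteq> 0 \<and> ieval p x = 0)"
  have f0: "f0 \<noteq> 0 \<and> ieval f0 x = 0"
    unfolding f0_def by (rule arg_min_natI[of _ g]) (use assms in simp)
  have minimal: "degree f0 \<le> degree p" if "p \<noteq> 0" "ieval p x = 0" for p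
    unfolding f0_def by (rule arg_min_nat_le) (use that in simp)
  define f where "f = primitive_part f0"
  have f: "f \<noteq> 0" "degree f = degree f0" "content f = 1"
    using f0 by (simp_all add: f_def)
  have "of_int (content f0) * ieval f x = 0"
    using f0 by (simp add: f_def flip: ieval_smult)
  then have root: "ieval f x = 0" using f0 by simp
  have "f dvd h" if h: "ieval h x = 0" for h
  proof -
    from pseudo_mod[OF f(1), of h] obtain c q
      where cq: "c \<noteq> 0" "smult c h = f * q + pseudo_mod h f"
        and deg: "pseudo_mod h f = 0 \<or> degree (pseudo_mod h f) < degree f"
      by blast
    have "ieval (smult c h) x = ieval (f * q + pseudo_mod h f) x" using cq by simp
    then have "ieval (pseudo_mod h f) x = 0"
      using h root by (simp add: ieval_add ieval_mult ieval_smult)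
    then have "pseudo_mod h f = 0" using minimal deg f by fastforce
    then have eq: "smult c h = f * q" using cq by simp
    \<comment> \<open>The factor \<open>c\<close> divides the content of the right-hand side, and \<open>f\<close> contributes nothing to it.\<close>
    have "content q = content (smult c h)" using f by (simp add: eq content_mult)
    then have "c dvd content q" by simp
    then have "[:c:] dvd q"
      using const_poly_dvd_iff_dvd_content by blast
    then obtain r where "q = smult c r" by auto
    then have "smult c h = smult c (f * r)" using eq by simp
    then have "smult c (h - f * r) = 0" by (simp add: smult_diff_right)
    then have "h = f * r" using cq(1) by simp
    then show ?thesis by simp
  qed
  with that f root show thesis by blast
qed

text \<open>
The idea is that \<open>P\<close> makes \<open>x\<close> an algebraic integer and \<open>h\<close> makes \<open>1/x\<close> one. The conjugates of such a unit
are common roots of \<open>P\<close> and \<open>h\<close>, and their product has absolute value 1, so they cannot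
all lie in the closed unit disc if one of them lies in its interior.
\<close>

lemma root_on_or_outside_unit_circle:
  fixes P h :: "int poly"
  assumes P: "is_unit (lead_coeff P)" "ieval P x = 0"
    and h: "is_unit (coeff h 0)" "ieval h x = 0"
    and roots: "\<And>z. ieval P z = 0 \<Longrightarrow> ieval h z = 0 \<Longrightarrow> norm z \<le> 1"
  shows "norm x \<ge> 1"
proof (rule ccontr)
  assume "\<not> norm x \<ge> 1"
  then have less: "norm x < 1" by simp
  have "P \<noteq> 0" using P(1) by auto
  with P(2) obtain f where f: "f \<noteq> 0" "ieval f x = 0" "\<And>h. ieval h x = 0 \<Longrightarrow> f dvd h"
    using primitive_minimal_divisor by blast
  from f(3)[OF P(2)] obtain u where u: "P = f * u" by blast
  from f(3)[OF h(2)] obtain v where v: "h = f * v" by blast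
  have "is_unit (lead_coeff f)"
    using P(1) unfolding u lead_coeff_mult by (rule dvd_mult_left)
  then have lc: "\<bar>lead_coeff f\<bar> = 1" by simp
  have "coeff h 0 = coeff f 0 * coeff v 0" by (simp add: v coeff_mult)
  then have "is_unit (coeff f 0)"
    using h(1) by (metis dvd_mult_left)
  then have c0: "\<bar>coeff f 0\<bar> = 1" by simp
  define F where "F = (map_poly of_int f :: complex poly)"
  have F0: "F \<noteq> 0" using f(1) by (simp add: F_def map_poly_eq_0_iff)
  have Fdecomp: "smult (lead_coeff F) (\<Prod>z\<in>#proots F. [:- z, 1:]) = F"
    by (rule complex_poly_decompose_multiset)
  have lF: "lead_coeff F = of_int (lead_coeff f)"
    unfolding F_def by (subst lead_coeff_map_poly_nz) (use f in auto)
  have lcF: "norm (lead_coeff F) = 1"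
    unfolding lF using lc by (simp flip: of_int_abs)
  have xF: "x \<in># proots F" using f(2) F0 by (simp add: F_def)
  then obtain A where A: "proots F = add_mset x A" by (metis multi_member_split)
  have small: "norm z \<le> 1" if "z \<in># proots F" for z
  proof -
    have "ieval f z = 0" using that F0 by (simp add: F_def)
    then show ?thesis by (intro roots) (simp_all add: u v ieval_mult)
  qed
  have prod_le: "norm (\<Prod>z\<in>#B. - z) \<le> 1" if "\<forall>z\<in>#B. norm z \<le> 1" for B :: "complex multiset"
    using that by (induction B) (auto simp: norm_mult intro: mult_le_one)
  \<comment> \<open>Vieta: up to sign, the constant coefficient is the product of all roots.\<close>
  have "poly F 0 = lead_coeff F * (\<Prod>z\<in>#proots F. - z)"
    by (subst Fdecomp[symmetric]) (simp add: poly_prod_mset image_mset.compositionality o_def)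
  then have "norm (poly F 0) = norm x * norm (\<Prod>z\<in>#A. - z)"
    by (simp add: norm_mult lcF A)
  also have "\<dots> \<le> norm x * 1"
    using small A by (intro mult_left_mono prod_le) auto
  finally have "norm (poly F 0) < 1" using less by simp
  moreover have "poly F 0 = of_int (coeff f 0)"
    by (simp add: F_def poly_0_coeff_0 coeff_map_poly)
  ultimately show False using c0 by (simp flip: of_int_abs)
qed

text \<open>
Where the contradiction comes from: with \<open>p = x\<^sup>a\<close> and \<open>q = x\<^sup>m\<close>, the identity
\<open>5p = 3(3p + 2q) - 2(2p + 3q)\<close> bounds \<open>p\<close>. A common complex root outside the unit circle would
have \<open>|3p + 2q| < 1\<close> by the second equation and \<open>2p + 3q = 1\<close> by the first, hence \<open>|p| < 1\<close>, although
\<open>p\<close> is a power of that root.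
\<close>

lemma resonance_equations_inconsistent:
  fixes x :: real
  assumes x: "0 < x" "x < 1" and "a \<noteq> m" "a \<ge> 1" "m \<ge> 1" "j \<ge> 1"
    and e1: "2 * x ^ a + 3 * x ^ m = 1"
    and e2: "x ^ j * (3 * x ^ a + 2 * x ^ m) = 1"
  shows False
proof -
  define h :: "int poly" where "h = monom 2 a + monom 3 m - monom 1 0"
  \<comment> \<open>Subtracting the first equation from the bracket in the second turns \<open>3p + 2q\<close> into \<open>p - q + 1\<close>.
    This makes the leading coefficient 1 or -1, whichever of \<open>a\<close> and \<open>m\<close> is larger.\<close>
  define P :: "int poly" where "P = monom 1 (a + j) - monom 1 (m + j) + monom 1 j - monom 1 0"
  have evP: "ieval P z = z ^ j * (z ^ a - z ^ m + 1) - 1"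
    and evh: "ieval h z = 2 * z ^ a + 3 * z ^ m - 1" for z
    by (simp_all add: P_def h_def ieval_add ieval_minus ieval_monom power_add algebra_simps)
  have linear: "x ^ a - x ^ m + 1 = 3 * x ^ a + 2 * x ^ m"
    using e1 by linarith
  have real_root: "x ^ j * (x ^ a - x ^ m + 1) - 1 = 0"
    unfolding linear e2 by simp
  have "ieval P (complex_of_real x) = of_real (x ^ j * (x ^ a - x ^ m + 1) - 1)"
    by (simp add: evP)
  then have P: "ieval P (complex_of_real x) = 0"
    by (simp only: real_root of_real_0)
  have "ieval h (complex_of_real x) = of_real (2 * x ^ a + 3 * x ^ m - 1)"
    by (simp add: evh)
  then have h: "ieval h (complex_of_real x) = 0"
    using e1 by simp
  have "coeff P (max a m + j) \<in> {1, -1}"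
    using \<open>a \<noteq> m\<close> \<open>a \<ge> 1\<close> \<open>m \<ge> 1\<close> by (simp add: P_def max_def)
  moreover have "degree P \<le> max a m + j"
    unfolding P_def by (intro degree_diff_le degree_add_le order.trans[OF degree_monom_le]) auto
  ultimately have "lead_coeff P \<in> {1, -1}"
    by (metis (no_types, lifting) coeff_eq_0 insert_iff le_eq_less_or_eq empty_iff zero_neq_one
        zero_neq_neg_one)
  then have lc: "is_unit (lead_coeff P)" by auto
  have c0: "is_unit (coeff h 0)"
    using \<open>a \<ge> 1\<close> \<open>m \<ge> 1\<close> by (simp add: h_def)
  have "norm z \<le> 1" if "ieval P z = 0" "ieval h z = 0" for z
  proof (rule ccontr)
    assume "\<not> norm z \<le> 1"
    then have z: "norm z > 1" by simp
    define p q where "p = z ^ a" and "q = z ^ m"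
    have E1: "2 * p + 3 * q = 1"
      using that(2) by (simp add: evh p_def q_def)
    have "z ^ j * (p - q + 1) = 1"
      using that(1) by (simp add: evP p_def q_def)
    also have "p - q + 1 = 3 * p + 2 * q"
      using E1 by (simp add: algebra_simps)
    finally have E2: "z ^ j * (3 * p + 2 * q) = 1" .
    have "norm z ^ j * norm (3 * p + 2 * q) = 1"
      using arg_cong[OF E2, of norm] by (simp add: norm_mult norm_power)
    then have "norm (3 * p + 2 * q) = 1 / norm z ^ j"
      using z by (subst eq_divide_eq) (auto simp: mult.commute)
    moreover have "norm z ^ j > 1"
      using z \<open>j \<ge> 1\<close> by (intro one_less_power) auto
    ultimately have less: "norm (3 * p + 2 * q) < 1"
      by (simp add: divide_less_eq)
    have "5 * p = 3 * (3 * p + 2 * q) - 2 * (2 * p + 3 * q)"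
      by (simp add: algebra_simps)
    then have "5 * p = 3 * (3 * p + 2 * q) - 2"
      by (simp only: E1 mult_1_right)
    then have "norm (5 * p) \<le> norm (3 * (3 * p + 2 * q)) + norm (2 :: complex)"
      by (metis norm_triangle_ineq4)
    then have "5 * norm p \<le> 3 * norm (3 * p + 2 * q) + 2"
      by (simp only: norm_mult norm_numeral)
    then have "norm p < 1" using less by simp
    moreover have "norm p > 1"
      using z \<open>a \<ge> 1\<close> by (simp add: p_def norm_power)
    ultimately show False by simp
  qed
  then have "norm (complex_of_real x) \<ge> 1"
    using root_on_or_outside_unit_circle[OF lc P c0 h] by blast
  then show False using x by simp
qed

section \<open>Absence of resonances on the critical curve\<close>

text \<open>
The second equation forces \<open>j < n\<close>, because its right-hand side is less than \<open>x\<^sup>j\<close>.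
Dividing it by \<open>x\<^sup>j\<close> gives a pair of equations for \<open>x ^ (n - j)\<close> and \<open>x\<^sup>m\<close> to which
\<open>resonance_equations_inconsistent\<close> applies.
\<close>

lemma no_resonance_positive_exponent:
  fixes x :: real
  assumes x: "0 < x" "x < 1" and "m \<noteq> n" "m \<ge> 1" "j \<ge> 1" and "3 * x ^ m < 1"
    and e1: "2 * x ^ m * x ^ j = 1 - 3 * x ^ n"
    and e2: "2 * x ^ n = x ^ j * (1 - 3 * x ^ m)"
  shows False
proof -
  have pos: "x ^ n > 0" "x ^ m > 0" "x ^ j > 0" using x by simp_all
  have "j < n"
  proof (rule ccontr)
    assume "\<not> j < n"
    then have "x ^ j \<le> x ^ n" using x by (intro power_decreasing) auto
    then have "2 * x ^ n \<le> x ^ n * (1 - 3 * x ^ m)"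
      unfolding e2 using assms by (intro mult_right_mono) auto
    also have "\<dots> < x ^ n * 1"
      using pos by (intro mult_strict_left_mono) auto
    finally show False using pos by simp
  qed
  define a where "a = n - j"
  have n: "n = j + a" and "a \<ge> 1" using \<open>j < n\<close> by (simp_all add: a_def)
  have "x ^ j * (2 * x ^ a) = x ^ j * (1 - 3 * x ^ m)"
    using e2 by (simp add: n power_add)
  then have f1: "2 * x ^ a + 3 * x ^ m = 1" using x by auto
  have f2: "x ^ j * (3 * x ^ a + 2 * x ^ m) = 1"
    using e1 by (simp add: n power_add algebra_simps)
  show False
  proof (cases "a = m")
    case True
    then have "x ^ j = 1" using f1 f2 by auto
    then show False using x \<open>j \<ge> 1\<close> power_less_one_iff[of x j] by simp
  next
    case False
    then show False
      using resonance_equations_inconsistent[OF x False] f1 f2 assms \<open>a \<ge> 1\<close> by blast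
  qed
qed

text \<open>
Let \<open>l = x\<^sup>n\<close> and \<open>k = x\<^sup>m\<close>. On the critical curve the ratio \<open>2k/(1 - 3l)\<close> equals \<open>(1 - 3k)/(2l)\<close>. Therefore a
resonance with exponent \<open>i\<close> is also a resonance with exponent \<open>-i\<close> after the roles of \<open>m\<close> and \<open>n\<close>
are exchanged, and only exponents of one sign have to be excluded. Exponent 0 would force \<open>l = k\<close>.
\<close>

lemma no_critical_resonance:
  fixes x :: real and i :: int
  assumes x: "0 < x" "x < 1" and mn: "m \<noteq> n" "m \<ge> 1" "n \<ge> 1"
    and small: "3 * x ^ m < 1" "3 * x ^ n < 1"
    and critical: "4 * x ^ n * x ^ m = (1 - 3 * x ^ n) * (1 - 3 * x ^ m)"
  shows "2 * x ^ m / (1 - 3 * x ^ n) \<noteq> x powi i"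
proof
  assume "2 * x ^ m / (1 - 3 * x ^ n) = x powi i"
  then have e: "2 * x ^ m = (1 - 3 * x ^ n) * x powi i"
    using small by (simp add: field_simps)
  have "(1 - 3 * x ^ n) * (2 * x ^ n * x powi i) = 2 * x ^ n * (2 * x ^ m)"
    by (simp add: e mult_ac)
  also have "\<dots> = (1 - 3 * x ^ n) * (1 - 3 * x ^ m)"
    by (simp flip: critical)
  finally have e': "2 * x ^ n * x powi i = 1 - 3 * x ^ m" using small by simp
  consider "i = 0" | j where "j \<ge> 1" "i = int j" | j where "j \<ge> 1" "i = - int j"
    by (cases i rule: int_cases4) (auto simp: Suc_le_eq)
  then show False
  proof cases
    case 1
    then have "x ^ m = x ^ n" using e e' by simp
    then show False using x mn power_inject_exp'[of x m n] by simp
  next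
    case 2
    then show False
      using no_resonance_positive_exponent[OF x, of n m j] e e' mn small by (simp add: mult.commute)
  next
    case 3
    then have inv: "x powi i * x ^ j = 1"
      using x by (simp add: power_int_minus field_simps)
    have "2 * x ^ m * x ^ j = 1 - 3 * x ^ n"
      unfolding e using inv by (simp add: mult.assoc)
    moreover have "2 * x ^ n = x ^ j * (1 - 3 * x ^ m)"
      unfolding e'[symmetric] using inv by (simp add: mult_ac)
    ultimately show False
      using no_resonance_positive_exponent[OF x, of m n j] 3 mn small by simp
  qed
qed

section \<open>Self-similarity of middle Cantor sets\<close>

lemma summable_digits:
  fixes l :: real
  assumes "0 < l" "l < 1" "\<And>k. a k \<le> M"
  shows "summable (\<lambda>k. real (a k) * l ^ k)"
proof (rule summable_comparison_test)
  show "\<exists>N. \<forall>k\<ge>N. norm (real (a k) * l ^ k) \<le> real M * l ^ k"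
    using assms by (auto intro!: mult_right_mono simp: abs_mult)
  show "summable (\<lambda>k. real M * l ^ k)"
    using assms by (intro summable_mult summable_geometric) simp
qed

lemma middle_cantorE:
  assumes "x \<in> middle_cantor M l"
  obtains a where "\<And>k. a k \<le> M" "x = (1 - l) / real M * (\<Sum>k. real (a k) * l ^ k)"
  using assms unfolding middle_cantor_def by fastforce

lemma middle_cantorI:
  assumes "\<And>k. a k \<le> M"
  shows "(1 - l) / real M * (\<Sum>k. real (a k) * l ^ k) \<in> middle_cantor M l"
  using assms unfolding middle_cantor_def by auto

lemma digits_split:
  fixes l :: real
  assumes "0 < l" "l < 1" "\<And>k. a k \<le> M"
  shows "(\<Sum>k. real (a k) * l ^ k) = real (a 0) + l * (\<Sum>k. real (a (Suc k)) * l ^ k)"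
proof -
  have "(\<Sum>k. real (a (Suc k)) * l ^ Suc k) = (\<Sum>k. l * (real (a (Suc k)) * l ^ k))"
    by (simp add: mult_ac)
  also have "\<dots> = l * (\<Sum>k. real (a (Suc k)) * l ^ k)"
    using assms by (intro suminf_mult summable_digits) auto
  finally show ?thesis
    using suminf_split_head[OF summable_digits[where a = a, OF assms]] by simp
qed

lemma middle_cantor_self_similar:
  assumes "0 < l" "l < 1"
  shows "middle_cantor M l = (\<Union>i\<in>{..M}. (\<lambda>y. (1 - l) / real M * real i + l * y) ` middle_cantor M l)"
proof (intro equalityI subsetI)
  fix x assume "x \<in> middle_cantor M l"
  then obtain a where a: "\<And>k. a k \<le> M" "x = (1 - l) / real M * (\<Sum>k. real (a k) * l ^ k)"
    by (elim middle_cantorE) blast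
  have "x = (1 - l) / real M * real (a 0) +
      l * ((1 - l) / real M * (\<Sum>k. real (a (Suc k)) * l ^ k))"
    unfolding a(2) by (subst digits_split[OF assms a(1)]) (simp add: algebra_simps)
  then show "x \<in> (\<Union>i\<in>{..M}. (\<lambda>y. (1 - l) / real M * real i + l * y) ` middle_cantor M l)"
    using a(1) middle_cantorI[of "\<lambda>k. a (Suc k)" M l] by blast
next
  fix x assume "x \<in> (\<Union>i\<in>{..M}. (\<lambda>y. (1 - l) / real M * real i + l * y) ` middle_cantor M l)"
  then obtain i y where i: "i \<le> M" "y \<in> middle_cantor M l"
    and x: "x = (1 - l) / real M * real i + l * y" by auto
  from i(2) obtain a where a: "\<And>k. a k \<le> M" "y = (1 - l) / real M * (\<Sum>k. real (a k) * l ^ k)"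
    by (elim middle_cantorE) blast
  define b where "b = case_nat i a"
  have b: "b k \<le> M" for k using i a by (cases k) (auto simp: b_def)
  have "(\<Sum>k. real (b k) * l ^ k) = real i + l * (\<Sum>k. real (a k) * l ^ k)"
    using digits_split[where a = b, OF assms b] by (simp add: b_def)
  then have "x = (1 - l) / real M * (\<Sum>k. real (b k) * l ^ k)"
    by (simp add: x a(2) algebra_simps)
  then show "x \<in> middle_cantor M l" using b middle_cantorI by metis
qed

lemma middle_cantor_piece:
  assumes "0 < l" "l < 1" "i \<le> M" "y \<in> middle_cantor M l"
  shows "(1 - l) / real M * real i + l * y \<in> middle_cantor M l"
  by (rule equalityD2[OF middle_cantor_self_similar[OF assms(1,2)], THEN subsetD])
    (use assms in auto)

text \<open>
Following a point of \<open>X\<close> backwards through the pieces yields digits; the remainder after \<open>N\<close> digits is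
\<open>l\<^sup>N\<close> times a point of the bounded set \<open>X\<close>, so the digit series converges to the given point. In particular
the Cantor set contains its own closure.
\<close>

lemma middle_cantor_greatest:
  assumes l: "0 < l" "l < 1" and "M \<ge> 1" and "bounded X"
    and cover: "X \<subseteq> (\<Union>i\<in>{..M}. (\<lambda>y. (1 - l) / real M * real i + l * y) ` X)"
  shows "X \<subseteq> middle_cantor M l"
proof
  fix x assume x: "x \<in> X"
  have "\<exists>d \<tau>. \<forall>x\<in>X. d x \<le> M \<and> \<tau> x \<in> X \<and> x = (1 - l) / real M * real (d x) + l * \<tau> x"
  proof -
    have "\<forall>x\<in>X. \<exists>i y. i \<le> M \<and> y \<in> X \<and> x = (1 - l) / real M * real i + l * y"
      using cover by blast
    then show ?thesis by (simp only: bchoice_iff)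
  qed
  then obtain d \<tau> where step: "\<And>x. x \<in> X \<Longrightarrow> d x \<le> M" "\<And>x. x \<in> X \<Longrightarrow> \<tau> x \<in> X"
    "\<And>x. x \<in> X \<Longrightarrow> x = (1 - l) / real M * real (d x) + l * \<tau> x" by blast
  define u where "u k = (\<tau> ^^ k) x" for k
  have u: "u k \<in> X" for k by (induction k) (simp_all add: u_def x step)
  have u_Suc: "u k = (1 - l) / real M * real (d (u k)) + l * u (Suc k)" for k
    using step(3)[OF u] by (simp add: u_def)
  have partial: "x = (1 - l) / real M * (\<Sum>k<N. real (d (u k)) * l ^ k) + l ^ N * u N" for N
  proof (induction N)
    case 0
    show ?case by (simp add: u_def)
  next
    case (Suc N)
    then show ?case
      by (subst (asm) (2) u_Suc) (simp add: algebra_simps)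
  qed
  have summ: "summable (\<lambda>k. real (d (u k)) * l ^ k)"
    using l step(1)[OF u] by (rule summable_digits)
  from \<open>bounded X\<close> obtain B where B: "\<And>y. y \<in> X \<Longrightarrow> norm y \<le> B" by (auto simp: bounded_iff)
  have "(\<lambda>N. l ^ N * u N) \<longlonglongrightarrow> 0"
  proof (rule Lim_null_comparison)
    show "\<forall>\<^sub>F N in sequentially. norm (l ^ N * u N) \<le> l ^ N * B"
      using l B[OF u] by (simp add: abs_mult)
    show "(\<lambda>N. l ^ N * B) \<longlonglongrightarrow> 0"
      using l by (intro tendsto_mult_left_zero LIMSEQ_power_zero) simp
  qed
  moreover have "(\<lambda>N. (1 - l) / real M * (\<Sum>k<N. real (d (u k)) * l ^ k))
      \<longlonglongrightarrow> (1 - l) / real M * (\<Sum>k. real (d (u k)) * l ^ k)"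
    by (intro tendsto_mult_left summable_LIMSEQ summ)
  ultimately have "(\<lambda>N. (1 - l) / real M * (\<Sum>k<N. real (d (u k)) * l ^ k) + l ^ N * u N)
      \<longlonglongrightarrow> (1 - l) / real M * (\<Sum>k. real (d (u k)) * l ^ k) + 0"
    by (intro tendsto_add)
  then have "(\<lambda>N. x) \<longlonglongrightarrow> (1 - l) / real M * (\<Sum>k. real (d (u k)) * l ^ k)"
    by (simp only: partial[symmetric] add_0_right)
  then have "x = (1 - l) / real M * (\<Sum>k. real (d (u k)) * l ^ k)"
    by (simp add: LIMSEQ_const_iff)
  then show "x \<in> middle_cantor M l"
    using middle_cantorI[of "\<lambda>k. d (u k)" M l] step(1)[OF u] by simp
qed

lemma middle_cantor_const:
  assumes "0 < l" "l < 1" "i \<le> M"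
  shows "real i / real M \<in> middle_cantor M l"
proof -
  have "(\<Sum>k. real i * l ^ k) = real i * (1 / (1 - l))"
    using assms by (simp add: suminf_mult suminf_geometric)
  then have eq: "real i / real M = (1 - l) / real M * (\<Sum>k. real i * l ^ k)"
    using assms by simp
  show ?thesis unfolding eq by (rule middle_cantorI) (rule assms)
qed

lemma middle_cantor_unit_interval:
  assumes "0 < l" "l < 1"
  shows "middle_cantor M l \<subseteq> {0..1}"
proof
  fix x assume "x \<in> middle_cantor M l"
  then obtain a where a: "\<And>k. a k \<le> M" "x = (1 - l) / real M * (\<Sum>k. real (a k) * l ^ k)"
    by (elim middle_cantorE) blast
  have summ: "summable (\<lambda>k. real (a k) * l ^ k)"
    using assms a(1) by (rule summable_digits)
  have "(\<Sum>k. real (a k) * l ^ k) \<le> (\<Sum>k. real M * l ^ k)"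
    using assms a(1) by (intro suminf_le summ summable_mult summable_geometric mult_right_mono) auto
  also have "\<dots> = real M / (1 - l)"
    using assms by (simp add: suminf_mult suminf_geometric)
  finally have "x \<le> (1 - l) / real M * (real M / (1 - l))"
    unfolding a(2) using assms by (intro mult_left_mono) auto
  also have "\<dots> \<le> 1" using assms by simp
  finally have "x \<le> 1" .
  moreover have "0 \<le> x"
    unfolding a(2) using assms summ by (intro mult_nonneg_nonneg suminf_nonneg) auto
  ultimately show "x \<in> {0..1}" by simp
qed

lemma compact_middle_cantor:
  assumes "0 < l" "l < 1" "M \<ge> 1"
  shows "compact (middle_cantor M l)"
proof -
  let ?f = "\<lambda>i y. (1 - l) / real M * real i + l * y"
  let ?K = "closure (middle_cantor M l)"
  have bounded: "bounded (middle_cantor M l)"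
    using middle_cantor_unit_interval[OF assms(1,2)] bounded_closed_interval bounded_subset by blast
  then have K: "compact ?K" by (simp add: compact_closure)
  have "compact (\<Union>i\<in>{..M}. ?f i ` ?K)"
    by (intro compact_UN compact_continuous_image K continuous_intros) auto
  then have closed: "closed (\<Union>i\<in>{..M}. ?f i ` ?K)" by (rule compact_imp_closed)
  have "middle_cantor M l = (\<Union>i\<in>{..M}. ?f i ` middle_cantor M l)"
    by (rule middle_cantor_self_similar[OF assms(1,2)])
  also have "\<dots> \<subseteq> (\<Union>i\<in>{..M}. ?f i ` ?K)"
    by (intro UN_mono image_mono closure_subset order_refl)
  finally have "?K \<subseteq> (\<Union>i\<in>{..M}. ?f i ` ?K)"
    using closed by (rule closure_minimal)
  then have "?K \<subseteq> middle_cantor M l"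
    using bounded by (intro middle_cantor_greatest[OF assms] bounded_closure)
  then have "?K = middle_cantor M l" using closure_subset by blast
  then show ?thesis using K by simp
qed

text \<open>
This is the difference set \<open>C\<^sub>l - C\<^sub>l\<close>: a difference of two binary digits is a ternary digit minus 1.
Centring it at 0 makes the three pieces symmetric.
\<close>

definition diff_cantor :: "real \<Rightarrow> real set" where
  "diff_cantor l = (\<lambda>x. 2 * x - 1) ` middle_cantor 2 l"

lemma diff_cantorD:
  assumes "0 < l" "l < 1" "u \<in> diff_cantor l"
  shows "\<exists>x\<in>middle_cantor 1 l. \<exists>y\<in>middle_cantor 1 l. u = x - y"
proof -
  from assms(3) obtain x where x: "x \<in> middle_cantor 2 l" "u = 2 * x - 1"
    by (auto simp: diff_cantor_def)
  from x(1) obtain a where a: "\<And>k. a k \<le> 2" "x = (1 - l) / real 2 * (\<Sum>k. real (a k) * l ^ k)"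
    by (elim middle_cantorE) blast
  define b c :: "nat \<Rightarrow> nat"
    where "b = (\<lambda>k. if a k = 0 then 0 else 1)" and "c = (\<lambda>k. if a k = 2 then 0 else 1)"
  have digit: "real (a k) = real (b k) - real (c k) + 1" for k
  proof -
    consider "a k = 0" | "a k = 1" | "a k = 2" using a(1)[of k] by linarith
    then show ?thesis by cases (simp_all add: b_def c_def)
  qed
  have summ: "summable (\<lambda>k. real (b k) * l ^ k)" "summable (\<lambda>k. real (c k) * l ^ k)"
    using assms by (auto intro!: summable_digits[where M = 1] simp: b_def c_def)
  have "(\<lambda>k. real (b k) * l ^ k - real (c k) * l ^ k + l ^ k) sums
      ((\<Sum>k. real (b k) * l ^ k) - (\<Sum>k. real (c k) * l ^ k) + 1 / (1 - l))"
    using assms by (intro sums_add sums_diff summable_sums summ geometric_sums) simp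
  moreover have "(\<lambda>k. real (b k) * l ^ k - real (c k) * l ^ k + l ^ k) =
      (\<lambda>k. real (a k) * l ^ k)"
    by (simp add: digit algebra_simps)
  ultimately have "(\<Sum>k. real (a k) * l ^ k) =
      (\<Sum>k. real (b k) * l ^ k) - (\<Sum>k. real (c k) * l ^ k) + 1 / (1 - l)"
    by (metis sums_unique)
  then have "u = (1 - l) / real 1 * (\<Sum>k. real (b k) * l ^ k)
      - (1 - l) / real 1 * (\<Sum>k. real (c k) * l ^ k)"
    using assms by (simp add: x(2) a(2) field_simps)
  moreover have "b k \<le> 1" "c k \<le> 1" for k by (simp_all add: b_def c_def)
  ultimately show ?thesis
    using middle_cantorI[of b 1 l] middle_cantorI[of c 1 l] by blast
qed

lemma diff_cantor_zero:
  assumes "0 < l" "l < 1"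
  shows "0 \<in> diff_cantor l"
proof -
  have "real 1 / real 2 \<in> middle_cantor 2 l"
    using assms by (intro middle_cantor_const) auto
  then have "2 * (real 1 / real 2) - 1 \<in> diff_cantor l"
    unfolding diff_cantor_def by (rule imageI)
  then show ?thesis by simp
qed

lemma diff_cantor_bounds:
  assumes "0 < l" "l < 1" "u \<in> diff_cantor l"
  shows "\<bar>u\<bar> \<le> 1"
proof -
  from assms(3) obtain x where x: "x \<in> middle_cantor 2 l" "u = 2 * x - 1"
    unfolding diff_cantor_def by blast
  then have "x \<in> {0..1}" using middle_cantor_unit_interval[OF assms(1,2)] by blast
  then show ?thesis by (simp add: x(2) abs_le_iff)
qed

lemma compact_diff_cantor: "0 < l \<Longrightarrow> l < 1 \<Longrightarrow> compact (diff_cantor l)"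
  unfolding diff_cantor_def
  by (intro compact_continuous_image compact_middle_cantor continuous_intros) auto

lemma diff_cantor_piece:
  assumes "0 < l" "l < 1" "u \<in> diff_cantor l" "i \<in> {-1, 0, 1}"
  shows "(1 - l) * i + l * u \<in> diff_cantor l"
proof -
  from assms(3) obtain x where x: "x \<in> middle_cantor 2 l" "u = 2 * x - 1"
    by (auto simp: diff_cantor_def)
  define d where "d = (if i = -1 then 0 else if i = 0 then 1 else 2 :: nat)"
  have d: "d \<le> 2" "real d = i + 1" using assms(4) by (auto simp: d_def)
  have "(1 - l) / real 2 * real d + l * x \<in> middle_cantor 2 l"
    using assms(1,2) d(1) x(1) by (rule middle_cantor_piece)
  moreover have "(1 - l) * i + l * u = 2 * ((1 - l) / real 2 * real d + l * x) - 1"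
    unfolding x(2) d(2) by (simp add: field_simps)
  ultimately show ?thesis unfolding diff_cantor_def by blast
qed

section \<open>An upper bound for the thickness\<close>

lemma ternary_cantor_pieces:
  fixes l :: real
  assumes "0 < l" "3 * l < 1" "x \<in> middle_cantor 2 l"
  shows "x \<in> {0..l} \<union> {(1 - l) / 2..(1 + l) / 2} \<union> {1 - l..1}"
proof -
  have "x \<in> (\<Union>i\<in>{..2}. (\<lambda>y. (1 - l) / real 2 * real i + l * y) ` middle_cantor 2 l)"
    by (rule equalityD1[OF middle_cantor_self_similar, THEN subsetD]) (use assms in auto)
  then obtain i y where i: "i \<le> 2" "y \<in> middle_cantor 2 l"
    and x: "x = (1 - l) / real 2 * real i + l * y"
    by auto
  have "0 \<le> y" "y \<le> 1" using middle_cantor_unit_interval[of l 2] assms i by auto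
  then have "0 \<le> l * y" "l * y \<le> l" using assms by auto
  moreover have "i = 0 \<or> i = 1 \<or> i = 2" using i by auto
  ultimately show ?thesis using x by (auto simp: field_simps)
qed

lemma ternary_cantor_image:
  fixes l :: real
  assumes "0 < l" "l < 1" "y \<in> middle_cantor 2 l" "i \<le> 2"
  shows "(1 - l) / 2 * real i + l * y \<in> middle_cantor 2 l"
  using middle_cantor_piece[OF assms(1,2) assms(4,3)] by simp

text \<open>
An interval that avoids the Cantor set either lies in a first-level gap or in the hull of one piece. In the
second case, blowing it up by \<open>1/l\<close> gives a longer interval of the same kind, and \<open>N\<close> repetitions
are possible only if the interval has length at most \<open>l\<^sup>N\<close>.
\<close>

lemma ternary_gap_length_aux:
  fixes l :: real
  assumes l: "0 < l" "3 * l < 1"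
    and "0 \<le> a" "b \<le> 1" "\<And>y. y \<in> middle_cantor 2 l \<Longrightarrow> y \<le> a \<or> b \<le> y"
  shows "b - a \<le> max ((1 - 3 * l) / 2) (l ^ N)"
  using assms(3-)
proof (induction N arbitrary: a b)
  case 0
  then show ?case by simp
next
  case (Suc N)
  let ?g = "(1 - 3 * l) / 2"
  have "l < 1" using l by simp
  note image = ternary_cantor_image[OF l(1) this]
  have ends: "0 \<in> middle_cantor 2 l" "1 \<in> middle_cantor 2 l"
    using middle_cantor_const[OF l(1) \<open>l < 1\<close>, of 0 2] middle_cantor_const[OF l(1) \<open>l < 1\<close>, of 2 2]
    by simp_all
  have scaled: "b - a \<le> max ?g (l ^ Suc N)"
    if i: "i \<le> 2" "(1 - l) / 2 * real i \<le> a" "b \<le> (1 - l) / 2 * real i + l" for i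
  proof -
    let ?s = "\<lambda>y. (y - (1 - l) / 2 * real i) / l"
    have "?s b - ?s a \<le> max ?g (l ^ N)"
    proof (rule Suc.IH)
      show "0 \<le> ?s a" "?s b \<le> 1" using i l by (simp_all add: field_simps)
      fix y assume "y \<in> middle_cantor 2 l"
      then have "(1 - l) / 2 * real i + l * y \<le> a \<or> b \<le> (1 - l) / 2 * real i + l * y"
        using Suc.prems(3) image i(1) by blast
      then show "y \<le> ?s a \<or> ?s b \<le> y"
        using l by (auto simp: pos_le_divide_eq pos_divide_le_eq mult.commute)
    qed
    also have "?s b - ?s a = (b - a) / l" by (simp add: diff_divide_distrib)
    finally have "b - a \<le> l * max ?g (l ^ N)" using l by (simp add: pos_divide_le_eq mult.commute)
    also have "\<dots> = max (l * ?g) (l ^ Suc N)" using l by (simp add: max_mult_distrib_left)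
    also have "\<dots> \<le> max ?g (l ^ Suc N)"
      using l mult_right_mono[of l 1 ?g] by (intro max.mono) auto
    finally show ?thesis .
  qed
  have avoid: "(1 - l) / 2 * real i \<le> a \<or> b \<le> (1 - l) / 2 * real i"
    "(1 - l) / 2 * real i + l \<le> a \<or> b \<le> (1 - l) / 2 * real i + l" if "i \<le> 2" for i
    using Suc.prems(3)[OF image[OF ends(1) that]] Suc.prems(3)[OF image[OF ends(2) that]]
    by simp_all
  show ?case
    using avoid[of 0] avoid[of 1] avoid[of 2] scaled[of 0] scaled[of 1] scaled[of 2] Suc.prems(1,2) l
    by (auto simp: field_simps max_def split: if_splits)
qed

lemma ternary_gap_length:
  fixes l :: real
  assumes l: "0 < l" "3 * l < 1"
    and "0 \<le> a" "b \<le> 1" "\<And>y. y \<in> middle_cantor 2 l \<Longrightarrow> y \<le> a \<or> b \<le> y"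
  shows "b - a \<le> (1 - 3 * l) / 2"
proof -
  have "(\<lambda>N. max ((1 - 3 * l) / 2) (l ^ N)) \<longlonglongrightarrow> max ((1 - 3 * l) / 2) 0"
    using l by (intro tendsto_max tendsto_const LIMSEQ_power_zero) auto
  then have "b - a \<le> max ((1 - 3 * l) / 2) 0"
    by (rule LIMSEQ_le_const) (use ternary_gap_length_aux[OF assms] in blast)
  then show ?thesis using l by simp
qed

lemma real_component_of_complementI:
  fixes K C :: "real set"
  assumes "C \<noteq> {}" "connected C" "C \<subseteq> - K"
    and "\<And>x y. x \<in> C \<Longrightarrow> y \<notin> C \<Longrightarrow> \<exists>z\<in>K. z \<in> closed_segment x y"
  shows "C \<in> components (- K)"
  unfolding in_components_maximal
proof (intro conjI allI impI assms(1-3))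
  fix D assume D: "D \<noteq> {} \<and> C \<subseteq> D \<and> D \<subseteq> - K \<and> connected D"
  obtain x where x: "x \<in> C" using assms(1) by blast
  have "y \<in> C" if "y \<in> D" for y
  proof (rule ccontr)
    assume "y \<notin> C"
    then obtain z where "z \<in> K" "z \<in> closed_segment x y" using assms(4) x by blast
    moreover have "closed_segment x y \<subseteq> D"
      using D x that by (intro closed_segment_subset) (auto simp flip: is_interval_convex_1 simp: is_interval_connected_1)
    ultimately show False using D by blast
  qed
  then show "D = C" using D by blast
qed

text \<open>
The gap \<open>(l, (1 - l)/2)\<close> has the bridge \<open>[0, l]\<close> at its left endpoint: the gaps inside \<open>[0, l]\<close> are
scaled by \<open>l\<close> and hence shorter, while \<open>[0, l]\<close> cannot be extended beyond either end without
meeting the gap itself or the unbounded gap on the left. The infimum is at most the quotient of these lengths.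
\<close>

lemma thickness_ternary_cantor_le:
  fixes l :: real
  assumes l: "0 < l" "3 * l < 1"
  shows "thickness (middle_cantor 2 l) \<le> ennreal (2 * l / (1 - 3 * l))"
proof -
  define K where "K = middle_cantor 2 l"
  define U where "U = {l<..<(1 - l) / 2}"
  have "l < 1" using l by simp
  have K_unit: "K \<subseteq> {0..1}"
    unfolding K_def using middle_cantor_unit_interval[OF l(1) \<open>l < 1\<close>] .
  have ends: "0 \<in> K" "1 \<in> K"
    using middle_cantor_const[OF l(1) \<open>l < 1\<close>, of 0 2] middle_cantor_const[OF l(1) \<open>l < 1\<close>, of 2 2]
    by (simp_all add: K_def)
  have image: "l * y \<in> K" if "y \<in> K" for y
    using ternary_cantor_image[OF l(1) \<open>l < 1\<close>, of y 0] that by (simp add: K_def)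
  have "l \<in> K" using image[OF ends(2)] by simp
  have "(1 - l) / 2 \<in> K"
    using ternary_cantor_image[OF l(1) \<open>l < 1\<close>, of 0 1] ends by (simp add: K_def)
  have U_gap: "U \<in> components (- K)"
  proof (rule real_component_of_complementI)
    show "U \<noteq> {}" using l by (simp add: U_def)
    show "connected U" by (simp add: U_def)
    show "U \<subseteq> - K" using ternary_cantor_pieces[OF l] l by (fastforce simp: U_def K_def)
    fix x y assume "x \<in> U" "y \<notin> U"
    then have "l \<in> closed_segment x y \<or> (1 - l) / 2 \<in> closed_segment x y"
      by (auto simp: U_def closed_segment_eq_real_ivl)
    then show "\<exists>z\<in>K. z \<in> closed_segment x y" using \<open>l \<in> K\<close> \<open>(1 - l) / 2 \<in> K\<close> by blast
  qed
  have left_gap: "{..<0} \<in> components (- K)"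
  proof (rule real_component_of_complementI)
    show "{..<0} \<subseteq> - K" using K_unit by auto
    fix x y :: real assume "x \<in> {..<0}" "y \<notin> {..<0}"
    then have "0 \<in> closed_segment x y" by (auto simp: closed_segment_eq_real_ivl)
    then show "\<exists>z\<in>K. z \<in> closed_segment x y" using ends(1) by blast
  qed (auto intro: lt_ex)
  have meas_U: "emeasure lborel U = ennreal ((1 - 3 * l) / 2)"
    using l by (simp add: U_def emeasure_lborel_Ioo field_simps)
  have "emeasure lborel U = emeasure lborel {-((1 - 3 * l) / 2)<..<0}"
    unfolding meas_U using l by simp
  also have "\<dots> \<le> emeasure lborel {..<0::real}"
    by (rule emeasure_mono) auto
  finally have left_long: "emeasure lborel U \<le> emeasure lborel {..<0::real}" .
  have candidate: "bridge_candidate K U l {0..l}"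
    unfolding bridge_candidate_def
  proof (intro conjI ballI impI)
    show "is_interval {0..l}" by simp
    show "l \<in> frontier {0..l}" using l by (simp add: frontier_def)
    fix V assume V: "V \<in> components (- K)" "emeasure lborel U \<le> emeasure lborel V"
    show "{0..l} \<inter> V = {}"
    proof (rule ccontr)
      assume "{0..l} \<inter> V \<noteq> {}"
      then obtain p where p: "0 \<le> p" "p \<le> l" "p \<in> V" by auto
      have VK: "V \<subseteq> - K" "is_interval V"
        using V(1) in_components_subset in_components_connected is_interval_connected_1 by blast+
      have between: "x \<in> V" if "y \<in> V" "z \<in> V" "y \<le> x" "x \<le> z" for x y z
        using VK(2) that by (meson mem_is_interval_1_I)
      have V_sub: "V \<subseteq> {0..l}"
      proof
        fix x assume "x \<in> V"
        then show "x \<in> {0..l}"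
          using between[OF \<open>x \<in> V\<close> p(3), of 0] between[OF p(3) \<open>x \<in> V\<close>, of l] p VK(1) ends \<open>l \<in> K\<close>
          by fastforce
      qed
      define a b where "a = Inf V" and "b = Sup V"
      have bdd: "bdd_below V" "bdd_above V" using V_sub by (meson bdd_below_Icc bdd_above_Icc bdd_below_mono bdd_above_mono)+
      have "0 \<le> a" unfolding a_def using V_sub p by (intro cInf_greatest) auto
      moreover have "b \<le> l" unfolding b_def using V_sub p by (intro cSup_least) auto
      moreover have Vab: "V \<subseteq> {a..b}"
        unfolding a_def b_def using cInf_lower[OF _ bdd(1)] cSup_upper[OF _ bdd(2)] by auto
      moreover have "a \<le> b" using subsetD[OF Vab p(3)] by simp
      ultimately have ab: "0 \<le> a" "b \<le> l" "V \<subseteq> {a..b}" "a \<le> b" by auto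
      \<comment> \<open>Blown up by \<open>1/l\<close>, the component is an interval in the unit interval that avoids the Cantor set.\<close>
      have "b / l - a / l \<le> (1 - 3 * l) / 2"
      proof (rule ternary_gap_length[OF l])
        show "0 \<le> a / l" "b / l \<le> 1" using ab l by simp_all
        fix y assume y: "y \<in> middle_cantor 2 l"
        show "y \<le> a / l \<or> b / l \<le> y"
        proof (rule ccontr)
          assume "\<not> ?thesis"
          then have "a < l * y" "l * y < b" using l by (auto simp: field_simps)
          then obtain v w where "v \<in> V" "v < l * y" "w \<in> V" "l * y < w"
            unfolding a_def b_def using p bdd by (metis cInf_lessD less_cSupD empty_iff)
          then have "l * y \<in> V" using between by (meson less_imp_le)
          then show False using VK(1) image y by (auto simp: K_def)
        qed
      qed
      then have "b - a \<le> l * ((1 - 3 * l) / 2)"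
        using l by (simp add: field_simps)
      also have "\<dots> < 1 * ((1 - 3 * l) / 2)"
        using l by (intro mult_strict_right_mono) auto
      finally have "b - a < (1 - 3 * l) / 2" by simp
      moreover have "emeasure lborel V \<le> emeasure lborel {a..b}"
        by (rule emeasure_mono) (use ab in auto)
      then have "emeasure lborel V \<le> ennreal (b - a)" using ab by simp
      ultimately have "emeasure lborel V < emeasure lborel U"
        unfolding meas_U using ab l by (meson ennreal_lessI le_less_trans half_gt_zero diff_gt_0_iff_gt)
      then show False using V(2) by simp
    qed
  qed
  have "bridge K U l {0..l}"
    unfolding bridge_def
  proof (intro conjI candidate allI impI)
    fix D assume D: "bridge_candidate K U l D \<and> {0..l} \<subseteq> D"
    then have Di: "is_interval D" and D0: "D \<inter> U = {}" "D \<inter> {..<0} = {}"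
      using U_gap left_gap left_long by (auto simp: bridge_candidate_def)
    have "x \<in> {0..l}" if "x \<in> D" for x
    proof (rule ccontr)
      assume "x \<notin> {0..l}"
      then have "x > l" using D0(2) that by force
      \<comment> \<open>This is \<open>x\<close> itself if \<open>x\<close> lies close to \<open>l\<close>, and otherwise the midpoint of the gap.\<close>
      define y where "y = min x ((1 + l) / 4)"
      have "l < y" "y \<le> x" "y < (1 - l) / 2"
        using \<open>x > l\<close> l by (auto simp: y_def min_def)
      moreover have "l \<in> D" using D l by auto
      ultimately have "y \<in> D" "y \<in> U"
        using Di that mem_is_interval_1_I[of D l x y] by (auto simp: U_def)
      then show False using D0(1) by blast
    qed
    then show "D = {0..l}" using D by blast
  qed
  moreover have "bounded_gap K U"
    using U_gap by (simp add: bounded_gap_def U_def)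
  moreover have "l \<in> frontier U" using l by (simp add: U_def frontier_def)
  ultimately have "thickness K \<le> emeasure lborel {0..l} / emeasure lborel U"
    unfolding thickness_def by (intro Inf_lower) blast
  also have "\<dots> = ennreal (2 * l / (1 - 3 * l))"
    unfolding meas_U using l by (simp add: divide_ennreal)
  finally show ?thesis by (simp add: K_def)
qed

lemma region_R_I:
  assumes "0 < l" "3 * l < 1" "0 < k" "3 * k < 1" "4 * l * k < (1 - 3 * l) * (1 - 3 * k)"
  shows "(l, k) \<in> region_R"
proof -
  have "thickness (middle_cantor 2 l) * thickness (middle_cantor 2 k)
      \<le> ennreal (2 * l / (1 - 3 * l)) * ennreal (2 * k / (1 - 3 * k))"
    using assms by (intro mult_mono thickness_ternary_cantor_le) auto
  also have "\<dots> = ennreal (2 * l / (1 - 3 * l) * (2 * k / (1 - 3 * k)))"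
    by (rule ennreal_mult[symmetric]) (use assms in auto)
  also have "2 * l / (1 - 3 * l) * (2 * k / (1 - 3 * k)) = 4 * l * k / ((1 - 3 * l) * (1 - 3 * k))"
    by simp
  also have "ennreal \<dots> < ennreal 1"
    using assms by (intro ennreal_lessI) (simp_all add: divide_less_eq_1_pos del: mult_less_cancel_left)
  finally show ?thesis using assms by (simp add: region_R_def)
qed

section \<open>Intersecting two difference sets\<close>

text \<open>
The pieces are \<open>p + s D\<^sub>l\<close> and \<open>q + t D\<^sub>k\<close>. The gaps of \<open>s D\<^sub>l\<close> between its first-level pieces have
length \<open>(1 - 3l) s\<close>, so the two inequalities with factor 3 say that neither hull fits into such an open
gap of the other piece. The set \<open>Q\<close> collects the ratios of half-lengths that are allowed to occur.
\<close>

definition linked :: "real \<Rightarrow> real \<Rightarrow> real set \<Rightarrow> real \<Rightarrow> real \<Rightarrow> real \<Rightarrow> real \<Rightarrow> bool" where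
  "linked l k Q p s q t \<longleftrightarrow> s > 0 \<and> t > 0 \<and> s / t \<in> Q \<and>
     (1 - 3 * k) * t \<le> 2 * s \<and> (1 - 3 * l) * s \<le> 2 * t \<and> \<bar>p - q\<bar> \<le> s + t"

text \<open>
Here \<open>d\<close> is the displacement of the centre of an interval of half-length \<open>t\<close>. An interval that is at
least as long as the gaps cannot slip between two neighbouring pieces.
\<close>

lemma piece_meets_interval:
  fixes l s t d :: real
  assumes "(1 - 3 * l) * s \<le> 2 * t" "\<bar>d\<bar> \<le> s + t"
  shows "\<exists>i\<in>{-1, 0, 1}. \<bar>d - s * ((1 - l) * i)\<bar> \<le> l * s + t"
proof -
  have "\<bar>d + (s - l * s)\<bar> \<le> l * s + t \<or> \<bar>d\<bar> \<le> l * s + t \<or> \<bar>d - (s - l * s)\<bar> \<le> l * s + t"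
    using assms by (auto simp: algebra_simps abs_if)
  then show ?thesis by (auto simp: algebra_simps)
qed

text \<open>
The last assumption says that no ratio in \<open>Q\<close> lies strictly inside the critical interval from \<open>2k/(1 - 3l)\<close> to
\<open>(1 - 3k)/(2l)\<close>; the two before it say that \<open>Q\<close> is stable under passing to subpieces.
\<close>

locale avoiding_ratios =
  fixes l k :: real and Q :: "real set"
  assumes l: "0 < l" "3 * l < 1" and k: "0 < k" "3 * k < 1"
    and Q_mult: "r \<in> Q \<Longrightarrow> l * r \<in> Q"
    and Q_divide: "r \<in> Q \<Longrightarrow> r / k \<in> Q"
    and Q_gap: "r \<in> Q \<Longrightarrow> 1 - 3 * k \<le> 2 * l * r \<or> (1 - 3 * l) * r \<le> 2 * k"
begin

lemma l_less_1: "l < 1" and k_less_1: "k < 1"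
  using l k by simp_all

text \<open>
The ratio decides which of the two pieces is subdivided: shrinking the first one must leave it long enough
for the gaps of the second, and conversely.
\<close>

lemma linked_step:
  assumes "linked l k Q p s q t"
  obtains p' s' q' t' where "linked l k Q p' s' q' t'" "s' * t' \<le> max l k * (s * t)"
    "\<And>u. u \<in> diff_cantor l \<Longrightarrow> \<exists>v\<in>diff_cantor l. p' + s' * u = p + s * v"
    "\<And>u. u \<in> diff_cantor k \<Longrightarrow> \<exists>v\<in>diff_cantor k. q' + t' * u = q + t * v"
proof -
  have st: "s > 0" "t > 0" "s / t \<in> Q" "(1 - 3 * k) * t \<le> 2 * s" "(1 - 3 * l) * s \<le> 2 * t"
    "\<bar>p - q\<bar> \<le> s + t"
    using assms by (auto simp: linked_def)
  show thesis
  proof (cases "1 - 3 * k \<le> 2 * l * (s / t)")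
    case True
    have "\<bar>q - p\<bar> \<le> s + t" using st(6) by (simp add: abs_minus_commute)
    from piece_meets_interval[OF st(5) this] obtain i
      where i: "i \<in> {-1, 0, 1}" "\<bar>q - p - s * ((1 - l) * i)\<bar> \<le> l * s + t"
      by blast
    have "l * ((1 - 3 * l) * s) \<le> 1 * (2 * t)"
      by (rule mult_mono) (use l st in auto)
    moreover have "(1 - 3 * k) * t \<le> 2 * (l * s)"
      using True st by (simp add: field_simps)
    ultimately have "linked l k Q (p + s * ((1 - l) * i)) (l * s) q t"
      unfolding linked_def using st l i Q_mult[OF st(3)] by (auto simp: mult_ac)
    moreover have "l * s * t \<le> max l k * (s * t)"
      using st by (simp add: mult.assoc mult_right_mono)
    moreover have "\<exists>v\<in>diff_cantor l. p + s * ((1 - l) * i) + l * s * u = p + s * v"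
      if "u \<in> diff_cantor l" for u
      using diff_cantor_piece[OF l(1) l_less_1 that i(1)]
      by (intro bexI[of _ "(1 - l) * i + l * u"]) (auto simp: algebra_simps)
    ultimately show thesis using that by blast
  next
    case False
    then have small: "(1 - 3 * l) * s \<le> 2 * (k * t)"
      using Q_gap[OF st(3)] st by (simp add: field_simps)
    have "\<bar>p - q\<bar> \<le> t + s" using st(6) by simp
    from piece_meets_interval[OF st(4) this] obtain i
      where i: "i \<in> {-1, 0, 1}" "\<bar>p - q - t * ((1 - k) * i)\<bar> \<le> k * t + s"
      by blast
    have "k * ((1 - 3 * k) * t) \<le> 1 * (2 * s)"
      by (rule mult_mono) (use k st in auto)
    moreover have "s / (k * t) = s / t / k" by simp
    ultimately have "linked l k Q p s (q + t * ((1 - k) * i)) (k * t)"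
      unfolding linked_def using st k i small Q_divide[OF st(3)] by (auto simp: mult_ac)
    moreover have "s * (k * t) \<le> max l k * (s * t)"
      using st by (simp add: mult.left_commute mult_right_mono)
    moreover have "\<exists>v\<in>diff_cantor k. q + t * ((1 - k) * i) + k * t * u = q + t * v"
      if "u \<in> diff_cantor k" for u
      using diff_cantor_piece[OF k(1) k_less_1 that i(1)]
      by (intro bexI[of _ "(1 - k) * i + k * u"]) (auto simp: algebra_simps)
    ultimately show thesis using that by blast
  qed
qed

lemma linked_descent:
  assumes "linked l k Q p s q t"
  shows "\<exists>p' s' q' t'. linked l k Q p' s' q' t' \<and> s' * t' \<le> max l k ^ N * (s * t) \<and>
    (\<forall>u\<in>diff_cantor l. \<exists>v\<in>diff_cantor l. p' + s' * u = p + s * v) \<and>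
    (\<forall>u\<in>diff_cantor k. \<exists>v\<in>diff_cantor k. q' + t' * u = q + t * v)"
proof (induction N)
  case 0
  show ?case
    using assms by (intro exI[of _ p] exI[of _ s] exI[of _ q] exI[of _ t]) auto
next
  case (Suc N)
  then obtain p1 s1 q1 t1 where 1: "linked l k Q p1 s1 q1 t1"
    "s1 * t1 \<le> max l k ^ N * (s * t)"
    "\<And>u. u \<in> diff_cantor l \<Longrightarrow> \<exists>v\<in>diff_cantor l. p1 + s1 * u = p + s * v"
    "\<And>u. u \<in> diff_cantor k \<Longrightarrow> \<exists>v\<in>diff_cantor k. q1 + t1 * u = q + t * v"
    by blast
  from linked_step[OF 1(1)] obtain p2 s2 q2 t2 where 2: "linked l k Q p2 s2 q2 t2"
    "s2 * t2 \<le> max l k * (s1 * t1)"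
    "\<And>u. u \<in> diff_cantor l \<Longrightarrow> \<exists>v\<in>diff_cantor l. p2 + s2 * u = p1 + s1 * v"
    "\<And>u. u \<in> diff_cantor k \<Longrightarrow> \<exists>v\<in>diff_cantor k. q2 + t2 * u = q1 + t1 * v"
    by blast
  have "max l k * (s1 * t1) \<le> max l k * (max l k ^ N * (s * t))"
    using 1(2) l by (intro mult_left_mono) auto
  then have "s2 * t2 \<le> max l k ^ Suc N * (s * t)"
    using 2(2) by (simp add: mult.assoc)
  moreover have "\<forall>u\<in>diff_cantor l. \<exists>v\<in>diff_cantor l. p2 + s2 * u = p + s * v"
    using 1(3) 2(3) by metis
  moreover have "\<forall>u\<in>diff_cantor k. \<exists>v\<in>diff_cantor k. q2 + t2 * u = q + t * v"
    using 1(4) 2(4) by metis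
  ultimately show ?case using 2(1) by blast
qed

text \<open>
The ratio of the lengths is bounded in both directions, so both lengths are small once their product is.
This is what turns the decay of the product in \<open>linked_descent\<close> into convergence.
\<close>

lemma linked_size:
  assumes "linked l k Q p s q t"
  shows "(s + t)\<^sup>2 \<le> (2 / (1 - 3 * l) + 2 + 2 / (1 - 3 * k)) * (s * t)"
proof -
  have st: "s > 0" "t > 0" "(1 - 3 * k) * t \<le> 2 * s" "(1 - 3 * l) * s \<le> 2 * t"
    using assms by (auto simp: linked_def)
  have le: "s \<le> 2 / (1 - 3 * l) * t" "t \<le> 2 / (1 - 3 * k) * s"
    using st l k by (simp_all add: field_simps)
  have "s * s \<le> s * (2 / (1 - 3 * l) * t)"
    by (rule mult_left_mono[OF le(1)]) (use st in simp)
  moreover have "t * t \<le> t * (2 / (1 - 3 * k) * s)"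
    by (rule mult_left_mono[OF le(2)]) (use st in simp)
  ultimately show ?thesis by (simp add: power2_eq_square algebra_simps)
qed

text \<open>
Subdividing produces points of the two pieces at arbitrarily small distance. As the pieces are
compact, their distance is attained, so it is 0 and they meet.
\<close>

lemma linked_meet:
  assumes "linked l k Q p s q t"
  shows "\<exists>u\<in>diff_cantor l. \<exists>v\<in>diff_cantor k. p + s * u = q + t * v"
proof -
  note zero = diff_cantor_zero[OF l(1) l_less_1] diff_cantor_zero[OF k(1) k_less_1]
  define \<delta> where "\<delta> = (\<lambda>w. \<bar>(p + s * fst w) - (q + t * snd w)\<bar>)"
  have "compact (diff_cantor l \<times> diff_cantor k)"
    using compact_diff_cantor l(1) l_less_1 k(1) k_less_1 by (intro compact_Times) auto
  moreover have "diff_cantor l \<times> diff_cantor k \<noteq> {}" using zero by auto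
  moreover have "continuous_on (diff_cantor l \<times> diff_cantor k) \<delta>"
    unfolding \<delta>_def by (intro continuous_intros)
  ultimately obtain w where w: "w \<in> diff_cantor l \<times> diff_cantor k"
    "\<And>w'. w' \<in> diff_cantor l \<times> diff_cantor k \<Longrightarrow> \<delta> w \<le> \<delta> w'"
    using continuous_attains_inf by metis
  define K where "K = 2 / (1 - 3 * l) + 2 + 2 / (1 - 3 * k)"
  have K: "K \<ge> 0" using l k by (simp add: K_def)
  have bound: "(\<delta> w)\<^sup>2 \<le> max l k ^ N * (K * (s * t))" for N
  proof -
    obtain p' s' q' t' where d: "linked l k Q p' s' q' t'"
      "s' * t' \<le> max l k ^ N * (s * t)"
      "\<forall>u\<in>diff_cantor l. \<exists>v\<in>diff_cantor l. p' + s' * u = p + s * v"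
      "\<forall>u\<in>diff_cantor k. \<exists>v\<in>diff_cantor k. q' + t' * u = q + t * v"
      using linked_descent[OF assms] by blast
    \<comment> \<open>The centres of the subpieces belong to the original pieces, because 0 belongs to the difference sets.\<close>
    from d(3) zero(1) obtain u where u: "u \<in> diff_cantor l" "p' = p + s * u" by fastforce
    from d(4) zero(2) obtain v where v: "v \<in> diff_cantor k" "q' = q + t * v" by fastforce
    have "\<delta> w \<le> \<delta> (u, v)" using w(2) u v by blast
    also have "\<dots> = \<bar>p' - q'\<bar>" by (simp add: \<delta>_def u v)
    also have "\<dots> \<le> s' + t'" using d(1) by (simp add: linked_def)
    finally have "(\<delta> w)\<^sup>2 \<le> (s' + t')\<^sup>2"
      by (intro power_mono) (auto simp: \<delta>_def)
    also have "\<dots> \<le> K * (s' * t')"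
      unfolding K_def by (rule linked_size[OF d(1)])
    also have "\<dots> \<le> K * (max l k ^ N * (s * t))"
      using d(2) K by (intro mult_left_mono)
    finally show ?thesis by (simp add: mult_ac)
  qed
  have "(\<lambda>N. max l k ^ N * (K * (s * t))) \<longlonglongrightarrow> 0"
    using l k by (intro tendsto_mult_left_zero LIMSEQ_power_zero) auto
  then have "(\<delta> w)\<^sup>2 \<le> 0"
    by (rule LIMSEQ_le_const) (use bound in blast)
  then have "p + s * fst w = q + t * snd w" by (simp add: \<delta>_def)
  then show ?thesis
    using w(1) by (intro bexI[of _ "fst w"] bexI[of _ "snd w"]) auto
qed

text \<open>
The full sets \<open>D\<^sub>l\<close> and \<open>c D\<^sub>k\<close> meet trivially at 0. The first subdivision is therefore made towards an outer
piece, all of whose points are positive.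
\<close>

lemma nonzero_common_direction:
  assumes c: "c > 0" "1 / c \<in> Q" "1 - 2 * l \<le> c" "c * (1 - 2 * k) \<le> 1"
    "(1 - 3 * k) * c \<le> 2" "1 - 3 * l \<le> 2 * c"
  shows "\<exists>u\<in>diff_cantor l. \<exists>v\<in>diff_cantor k. u = c * v \<and> u \<noteq> 0"
proof (cases "1 - 3 * k \<le> 2 * l * (1 / c)")
  case True
  have "l * (1 - 3 * l) \<le> 1 * (2 * c)"
    by (rule mult_mono) (use l c in auto)
  moreover have "(1 - 3 * k) * c \<le> 2 * l"
    using True c by (simp add: field_simps)
  ultimately have "linked l k Q (1 - l) l 0 c"
    unfolding linked_def using c l Q_mult[OF c(2)] by (auto simp: mult_ac)
  then obtain u v where uv: "u \<in> diff_cantor l" "v \<in> diff_cantor k" "1 - l + l * u = 0 + c * v"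
    using linked_meet by blast
  have "(1 - l) * 1 + l * u \<in> diff_cantor l"
    using diff_cantor_piece l(1) l_less_1 uv(1) by blast
  moreover have "\<bar>l * u\<bar> \<le> l"
    using diff_cantor_bounds[OF l(1) l_less_1 uv(1)] l by (simp add: abs_mult)
  then have "(1 - l) * 1 + l * u \<noteq> 0" using l by simp
  ultimately show ?thesis using uv by auto
next
  case False
  then have small: "1 - 3 * l \<le> 2 * (c * k)"
    using Q_gap[OF c(2)] c by (simp add: field_simps)
  have "k * ((1 - 3 * k) * c) \<le> 1 * 2"
    by (rule mult_mono) (use k c in auto)
  moreover have "\<bar>0 - c * (1 - k)\<bar> \<le> 1 + c * k"
    using c k by (simp add: abs_mult algebra_simps)
  moreover have "1 / (c * k) = 1 / c / k" by simp
  ultimately have "linked l k Q 0 1 (c * (1 - k)) (c * k)"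
    unfolding linked_def using c k small Q_divide[OF c(2)] by (simp add: mult_ac)
  then obtain u v where uv: "u \<in> diff_cantor l" "v \<in> diff_cantor k"
    "0 + 1 * u = c * (1 - k) + c * k * v"
    using linked_meet by blast
  have "(1 - k) * 1 + k * v \<in> diff_cantor k"
    using diff_cantor_piece k(1) k_less_1 uv(2) by blast
  moreover have "\<bar>k * v\<bar> \<le> k"
    using diff_cantor_bounds[OF k(1) k_less_1 uv(2)] k by (simp add: abs_mult)
  then have "(1 - k) * 1 + k * v > 0" using k by simp
  moreover have "u = c * ((1 - k) * 1 + k * v)" using uv(3) by (simp add: algebra_simps)
  ultimately show ?thesis using uv(1) c by (metis mult_pos_pos less_irrefl)
qed

end

section \<open>Directions close to the diagonal\<close>

lemma IP_cantorI:
  assumes l: "0 < l" "l < 1" and k: "0 < k" "k < 1" and t: "0 < t" "t < pi"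
    and uv: "u \<in> diff_cantor l" "v \<in> diff_cantor k" "u = cot t * v" "u \<noteq> 0"
  shows "t \<in> IP_cantor (l, k)"
proof -
  obtain x x' where x: "x \<in> middle_cantor 1 l" "x' \<in> middle_cantor 1 l" "u = x - x'"
    using diff_cantorD[OF l uv(1)] by blast
  obtain y y' where y: "y \<in> middle_cantor 1 k" "y' \<in> middle_cantor 1 k" "v = y - y'"
    using diff_cantorD[OF k uv(2)] by blast
  have "proj t (x, y) = proj t (x', y')"
    using t uv(3) by (simp add: proj_def x y algebra_simps)
  moreover have "(x, y) \<noteq> (x', y')" using uv(4) x by simp
  ultimately have "\<not> inj_on (proj t) (middle_cantor 1 l \<times> middle_cantor 1 k)"
    using x y unfolding inj_on_def by blast
  then show ?thesis using t by (simp add: IP_cantor_def IP_def)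
qed

text \<open>
By \<open>gap\<close>, the critical interval of ratios lies strictly between two consecutive powers of \<open>g\<close>.
Then it still avoids all numbers \<open>g\<^sup>i / c\<close> for \<open>c\<close> close to 1, and \<open>c = cot t\<close> is close to 1 for \<open>t\<close> close to \<open>\<pi>/4\<close>.
\<close>

lemma IP_cantor_neighborhood:
  fixes g :: real and j :: int
  assumes g: "g > 1"
    and small: "3 * g powi (- int n) < 1" "3 * g powi (- int m) < 1"
    and gap: "g powi j < 2 * g powi (- int m) / (1 - 3 * g powi (- int n))"
      "(1 - 3 * g powi (- int m)) / (2 * g powi (- int n)) < g powi (j + 1)"
  shows "\<exists>a b. a < pi / 4 \<and> pi / 4 < b \<and> {a<..<b} \<subseteq> IP_cantor (r_curve m n g)"
proof -
  define l k where "l = g powi (- int n)" and "k = g powi (- int m)"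
  have l: "0 < l" "3 * l < 1" and k: "0 < k" "3 * k < 1"
    using g small by (simp_all add: l_def k_def zero_less_power_int)
  have good: "t \<in> IP_cantor (l, k)"
    if t: "0 < t" "t < pi" and c: "cot t > 0" "1 - 2 * l < cot t" "cot t * (1 - 2 * k) < 1"
      "(1 - 3 * k) * cot t < 2" "1 - 3 * l < 2 * cot t"
      "g powi j < 2 * k / (1 - 3 * l) * cot t" "(1 - 3 * k) / (2 * l) * cot t < g powi (j + 1)"
    for t
  proof -
    define Q where "Q = range (\<lambda>i. 1 / cot t * g powi i)"
    interpret avoiding_ratios l k Q
    proof
      show "l * r \<in> Q" if "r \<in> Q" for r
      proof -
        from that obtain i where "r = 1 / cot t * g powi i" by (auto simp: Q_def)
        then have "l * r = 1 / cot t * g powi (- int n + i)"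
          using g unfolding l_def by (subst power_int_add) auto
        then show ?thesis unfolding Q_def by blast
      qed
      show "r / k \<in> Q" if "r \<in> Q" for r
      proof -
        from that obtain i where "r = 1 / cot t * g powi i" by (auto simp: Q_def)
        then have "r / k = 1 / cot t * g powi (i - (- int m))"
          using g unfolding k_def by (subst power_int_diff) auto
        then show ?thesis unfolding Q_def by blast
      qed
      show "1 - 3 * k \<le> 2 * l * r \<or> (1 - 3 * l) * r \<le> 2 * k" if "r \<in> Q" for r
      proof -
        from that obtain i where r: "r = 1 / cot t * g powi i" by (auto simp: Q_def)
        show ?thesis
        proof (cases "i \<le> j")
          case True
          then have "g powi i \<le> g powi j" using g by (intro power_int_increasing) auto
          also have "\<dots> \<le> 2 * k / (1 - 3 * l) * cot t" using c by simp
          finally show ?thesis using l k c by (simp add: r field_simps)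
        next
          case False
          have "(1 - 3 * k) / (2 * l) * cot t \<le> g powi (j + 1)" using c by simp
          also have "\<dots> \<le> g powi i" using g False by (intro power_int_increasing) auto
          finally show ?thesis using l k c by (simp add: r field_simps)
        qed
      qed
    qed (use l k in auto)
    have "1 / cot t * g powi 0 \<in> Q" unfolding Q_def by blast
    then have "1 / cot t \<in> Q" by simp
    then obtain u v where "u \<in> diff_cantor l" "v \<in> diff_cantor k" "u = cot t * v" "u \<noteq> 0"
      using nonzero_common_direction[of "cot t"] c by auto
    then show ?thesis using IP_cantorI l_less_1 k_less_1 l(1) k(1) t by blast
  qed
  have cot: "(cot \<longlongrightarrow> 1) (nhds (pi / 4))"
    using isCont_cot[of "pi / 4"] unfolding isCont_def tendsto_at_iff_tendsto_nhds
    by (simp add: cot_altdef tan_45 sin_45)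
  have gap': "g powi j < 2 * k / (1 - 3 * l) * 1" "(1 - 3 * k) / (2 * l) * 1 < g powi (j + 1)"
    using gap by (simp_all add: l_def k_def)
  have "\<forall>\<^sub>F t in nhds (pi / 4). t \<in> IP_cantor (l, k)"
  proof -
    have "\<forall>\<^sub>F t in nhds (pi / 4). t \<in> {0<..<pi}"
      by (intro eventually_nhds_in_open) auto
    moreover have "\<forall>\<^sub>F t in nhds (pi / 4). cot t > 0"
      by (rule order_tendstoD[OF cot]) simp
    moreover have "\<forall>\<^sub>F t in nhds (pi / 4). 1 - 2 * l < cot t"
      by (rule order_tendstoD[OF cot]) (use l in simp)
    moreover have "\<forall>\<^sub>F t in nhds (pi / 4). cot t * (1 - 2 * k) < 1"
      by (rule order_tendstoD[OF tendsto_mult_right[OF cot]]) (use k in simp)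
    moreover have "\<forall>\<^sub>F t in nhds (pi / 4). (1 - 3 * k) * cot t < 2"
      by (rule order_tendstoD[OF tendsto_mult_left[OF cot]]) (use k in simp)
    moreover have "\<forall>\<^sub>F t in nhds (pi / 4). 1 - 3 * l < 2 * cot t"
      by (rule order_tendstoD[OF tendsto_mult_left[OF cot]]) (use l in simp)
    moreover have "\<forall>\<^sub>F t in nhds (pi / 4). g powi j < 2 * k / (1 - 3 * l) * cot t"
      by (rule order_tendstoD[OF tendsto_mult_left[OF cot]]) (rule gap')
    moreover have "\<forall>\<^sub>F t in nhds (pi / 4). (1 - 3 * k) / (2 * l) * cot t < g powi (j + 1)"
      by (rule order_tendstoD[OF tendsto_mult_left[OF cot]]) (rule gap')
    ultimately show ?thesis
      by eventually_elim (use good in auto)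
  qed
  then obtain e where e: "e > 0" "\<And>t. dist t (pi / 4) < e \<Longrightarrow> t \<in> IP_cantor (l, k)"
    unfolding eventually_nhds_metric by blast
  have "{pi / 4 - e<..<pi / 4 + e} \<subseteq> IP_cantor (l, k)"
    using e(2) by (auto simp: dist_real_def abs_less_iff)
  then show ?thesis
    using e(1) by (intro exI[of _ "pi / 4 - e"] exI[of _ "pi / 4 + e"])
      (simp add: r_curve_def l_def k_def)
qed

section \<open>The curve near the critical parameter\<close>

text \<open>
In terms of \<open>x = 1/\<gamma>\<close>, the product of the thicknesses is 1 exactly when \<open>4 x\<^sup>n x\<^sup>m = (1 - 3 x\<^sup>n)(1 - 3 x\<^sup>m)\<close>.
The left-hand side grows with \<open>x\<close> and the right-hand side decreases, as long as both factors are positive.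
\<close>

lemma critical_parameter:
  fixes m n :: nat
  assumes "m \<ge> 1" "n \<ge> 1"
  obtains x0 :: real where "0 < x0" "x0 < 1" "3 * x0 ^ m < 1" "3 * x0 ^ n < 1"
    "4 * x0 ^ n * x0 ^ m = (1 - 3 * x0 ^ n) * (1 - 3 * x0 ^ m)"
    "\<And>x. 0 < x \<Longrightarrow> x < x0 \<Longrightarrow> 4 * x ^ n * x ^ m < (1 - 3 * x ^ n) * (1 - 3 * x ^ m)"
proof -
  define N where "N = min m n"
  have N: "N \<ge> 1" "N \<le> m" "N \<le> n" "N = m \<or> N = n" using assms by (auto simp: N_def)
  \<comment> \<open>The right end of the admissible range: here the larger of the two powers reaches 1/3.\<close>
  define x1 where "x1 = root N (1 / 3)"
  have x1: "x1 > 0" "x1 < 1" "x1 ^ N = 1 / 3"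
    using N by (simp_all add: x1_def real_root_gt_zero)
  define G :: "real \<Rightarrow> real" where "G x = 4 * x ^ n * x ^ m - (1 - 3 * x ^ n) * (1 - 3 * x ^ m)" for x
  have "(1 - 3 * x1 ^ n) * (1 - 3 * x1 ^ m) = 0" using N(4) x1(3) by auto
  then have "G x1 = 4 * x1 ^ n * x1 ^ m" by (simp only: G_def diff_zero)
  then have "G x1 > 0" using x1 by simp
  moreover have "G 0 = -1" using assms by (simp add: G_def power_0_left)
  moreover have "continuous_on {0..x1} G" unfolding G_def by (intro continuous_intros)
  ultimately obtain x0 where x0: "0 \<le> x0" "x0 \<le> x1" "G x0 = 0"
    using IVT'[of G 0 0 x1] x1 by auto
  have "x0 \<noteq> 0" "x0 \<noteq> x1" using x0(3) \<open>G x1 > 0\<close> \<open>G 0 = -1\<close> by auto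
  then have x01: "0 < x0" "x0 < x1" "x0 < 1" using x0 x1 by auto
  have "x0 ^ N < x1 ^ N" using x01 N by (intro power_strict_mono) auto
  moreover have "x0 ^ m \<le> x0 ^ N" "x0 ^ n \<le> x0 ^ N"
    using x01 N by (auto intro: power_decreasing)
  ultimately have small: "3 * x0 ^ m < 1" "3 * x0 ^ n < 1" using x1(3) by linarith+
  have "4 * x ^ n * x ^ m < (1 - 3 * x ^ n) * (1 - 3 * x ^ m)" if "0 < x" "x < x0" for x
  proof -
    have less: "x ^ n < x0 ^ n" "x ^ m < x0 ^ m"
      using that assms by (auto intro!: power_strict_mono)
    have pos: "0 < x ^ n" "0 < x ^ m" using that by simp_all
    have "4 * (x ^ n * x ^ m) < 4 * (x0 ^ n * x0 ^ m)"
      using less pos by (intro mult_strict_left_mono mult_strict_mono) auto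
    also have "\<dots> = (1 - 3 * x0 ^ n) * (1 - 3 * x0 ^ m)"
      using x0(3) by (simp add: G_def)
    also have "\<dots> \<le> (1 - 3 * x ^ n) * (1 - 3 * x ^ m)"
      using less small by (intro mult_mono) auto
    finally show ?thesis by simp
  qed
  then show thesis using that[of x0] x01 small x0(3) by (simp add: G_def)
qed

lemma power_int_neg_eq_power: "g powi (- int k) = (inverse g) ^ k" for g :: real
  by (simp add: power_int_minus power_inverse)

lemma powi_between:
  fixes g b :: real
  assumes "g > 1" "b > 0" "\<And>i::int. b \<noteq> g powi i"
  obtains k :: int where "g powi k < b" "b < g powi (k + 1)"
proof -
  define k where "k = \<lfloor>log g b\<rfloor>"
  have "real_of_int k \<le> log g b" "log g b < real_of_int (k + 1)" by (simp_all add: k_def)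
  then have "g powr real_of_int k \<le> b" "b < g powr real_of_int (k + 1)"
    using assms by (simp_all add: le_log_iff log_less_iff)
  moreover have "g powr real_of_int i = g powi i" for i
    using assms(1) by (intro powr_real_of_int') auto
  ultimately have "g powi k \<le> b" "b < g powi (k + 1)" by metis+
  with assms(3)[of k] that[of k] show thesis by force
qed

lemma smooth_r_curve: 
  assumes "I \<subseteq> {0<..}"
  shows "smooth_curve_on I (r_curve m n)"
proof -
  \<comment> \<open>The falling factorials that arise from differentiating \<open>g powi e\<close> repeatedly.\<close>
  define c :: "int \<Rightarrow> nat \<Rightarrow> real" where "c e k = (\<Prod>i<k. of_int (e - int i))" for e k
  define P where "P e k g = c e k * g powi (e - int k)" for e k and g :: real
  have deriv: "(P e k has_vector_derivative P e (Suc k) g) (at g within I)" if "g \<in> I" for e k g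
  proof -
    have "g \<noteq> 0" using assms that by auto
    then have "(P e k has_real_derivative c e k * (of_int (e - int k) * g powi (e - int k - 1)))
        (at g within I)"
      unfolding P_def by (auto intro!: derivative_eq_intros)
    also have "c e k * (of_int (e - int k) * g powi (e - int k - 1)) = P e (Suc k) g"
      by (simp add: P_def c_def algebra_simps)
    finally show ?thesis by (simp add: has_real_derivative_iff_has_vector_derivative)
  qed
  show ?thesis
    unfolding smooth_curve_on_def
  proof (intro exI[of _ "\<lambda>k g. (P (- int n) k g, P (- int m) k g)"] conjI allI ballI)
    show "(P (- int n) 0 t, P (- int m) 0 t) = r_curve m n t" for t
      by (simp add: P_def c_def r_curve_def)
    show "((\<lambda>g. (P (- int n) k g, P (- int m) k g)) has_vector_derivative
        (P (- int n) (Suc k) t, P (- int m) (Suc k) t)) (at t within I)" if "t \<in> I" for k t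
      by (intro has_vector_derivative_Pair deriv that)
  qed
qed

theorem proposition1:
  fixes m n :: nat
  assumes "m \<ge> 1" and "n \<ge> 1" and "m \<noteq> n"
  shows "\<exists>I :: real set.
    is_interval I \<and> (\<exists>a\<in>I. \<exists>b\<in>I. a < b) \<and> I \<subseteq> {1<..} \<and>
    r_curve m n ` I \<subseteq> region_R \<and>
    smooth_curve_on I (r_curve m n) \<and>
    (\<forall>\<gamma>\<in>I. \<exists>a b. a < pi / 4 \<and> pi / 4 < b \<and> {a<..<b} \<subseteq> IP_cantor (r_curve m n \<gamma>))"
proof -
  obtain x0 :: real where x0: "0 < x0" "x0 < 1" "3 * x0 ^ m < 1" "3 * x0 ^ n < 1"
    and critical: "4 * x0 ^ n * x0 ^ m = (1 - 3 * x0 ^ n) * (1 - 3 * x0 ^ m)"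
    and below: "\<And>x. 0 < x \<Longrightarrow> x < x0 \<Longrightarrow> 4 * x ^ n * x ^ m < (1 - 3 * x ^ n) * (1 - 3 * x ^ m)"
    using critical_parameter[OF assms(1,2)] by blast
  define g0 where "g0 = inverse x0"
  define l k :: "real \<Rightarrow> real" where "l = (\<lambda>g. g powi (- int n))" and "k = (\<lambda>g. g powi (- int m))"
  have g0: "g0 > 1" "inverse g0 = x0" using x0 by (simp_all add: g0_def one_less_inverse)
  have lk0: "l g0 = x0 ^ n" "k g0 = x0 ^ m" by (simp_all only: l_def k_def power_int_neg_eq_power g0)
  \<comment> \<open>At the critical parameter, the critical interval of ratios degenerates to this point.\<close>
  define b0 where "b0 = 2 * k g0 / (1 - 3 * l g0)"
  have b0_alt: "b0 = (1 - 3 * k g0) / (2 * l g0)"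
    using critical x0 by (simp add: b0_def lk0 field_simps)
  have "g0 powi i = x0 powi (- i)" for i
    by (simp add: g0_def power_int_minus power_int_inverse)
  then have "b0 \<noteq> g0 powi i" for i
    using no_critical_resonance[OF x0(1,2) assms(3,1,2) x0(3,4) critical, of "- i"]
    unfolding b0_def lk0 by simp
  moreover have "b0 > 0" using x0 by (simp add: b0_def lk0)
  ultimately obtain j where j: "g0 powi j < b0" "b0 < g0 powi (j + 1)"
    using powi_between g0(1) by blast
  \<comment> \<open>The two strict inequalities at the critical parameter persist slightly to the right of it.\<close>
  have "((\<lambda>g. 2 * k g / (1 - 3 * l g) - g powi j) \<longlongrightarrow> b0 - g0 powi j) (at_right g0)"
    unfolding b0_def l_def k_def using g0 x0 lk0
    by (intro tendsto_intros) (auto simp: l_def)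
  then have ev1: "\<forall>\<^sub>F g in at_right g0. 0 < 2 * k g / (1 - 3 * l g) - g powi j"
    by (rule order_tendstoD) (use j in simp)
  have "((\<lambda>g. (1 - 3 * k g) / (2 * l g) - g powi (j + 1)) \<longlongrightarrow> b0 - g0 powi (j + 1)) (at_right g0)"
    unfolding b0_alt l_def k_def using g0 x0 lk0
    by (intro tendsto_intros) (auto simp: l_def)
  then have ev2: "\<forall>\<^sub>F g in at_right g0. (1 - 3 * k g) / (2 * l g) - g powi (j + 1) < 0"
    by (rule order_tendstoD) (use j in simp)
  from eventually_conj[OF ev1 ev2] obtain g1 where g1: "g1 > g0"
    "\<And>g. g0 < g \<Longrightarrow> g < g1 \<Longrightarrow> g powi j < 2 * k g / (1 - 3 * l g)"
    "\<And>g. g0 < g \<Longrightarrow> g < g1 \<Longrightarrow> (1 - 3 * k g) / (2 * l g) < g powi (j + 1)"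
    unfolding eventually_at_right_field by auto
  define I where "I = {g0<..<g1}"
  have I: "g > 1" "0 < inverse g" "inverse g < x0" if "g \<in> I" for g
  proof -
    have "g0 < g" using that by (simp add: I_def)
    then show "g > 1" "0 < inverse g" "inverse g < x0"
      using g0 less_imp_inverse_less[of g0 g] by auto
  qed
  have small: "3 * g powi (- int n) < 1" "3 * g powi (- int m) < 1" if "g \<in> I" for g
  proof -
    have "inverse g ^ n \<le> x0 ^ n" "inverse g ^ m \<le> x0 ^ m"
      using I[OF that] by (auto intro!: power_mono)
    then show "3 * g powi (- int n) < 1" "3 * g powi (- int m) < 1"
      using x0 by (simp_all only: power_int_neg_eq_power)
  qed
  have region: "r_curve m n g \<in> region_R" if "g \<in> I" for g
  proof -
    have "4 * g powi (- int n) * g powi (- int m) <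
        (1 - 3 * g powi (- int n)) * (1 - 3 * g powi (- int m))"
      unfolding power_int_neg_eq_power using below I[OF that] by blast
    then show ?thesis
      unfolding r_curve_def using small[OF that] I(1)[OF that]
      by (intro region_R_I) (auto simp: zero_less_power_int)
  qed
  show ?thesis
  proof (intro exI[of _ I] conjI ballI)
    show "is_interval I" by (simp add: I_def is_interval_1)
    show "\<exists>a\<in>I. \<exists>b\<in>I. a < b"
    proof -
      obtain a where "g0 < a" "a < g1" using dense g1(1) by blast
      moreover obtain b where "a < b" "b < g1" using dense calculation(2) by blast
      ultimately show ?thesis unfolding I_def by (intro bexI[of _ a] bexI[of _ b]) auto
    qed
    show "I \<subseteq> {1<..}" using I(1) by auto
    show "r_curve m n ` I \<subseteq> region_R" using region by blast
    show "smooth_curve_on I (r_curve m n)"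
      using I(1) by (intro smooth_r_curve) force
    show "\<exists>a b. a < pi / 4 \<and> pi / 4 < b \<and> {a<..<b} \<subseteq> IP_cantor (r_curve m n g)" if "g \<in> I" for g
    proof (rule IP_cantor_neighborhood[where j = j])
      show "g > 1" using I that by blast
      show "3 * g powi (- int n) < 1" "3 * g powi (- int m) < 1" using small that by auto
      show "g powi j < 2 * g powi (- int m) / (1 - 3 * g powi (- int n))"
        "(1 - 3 * g powi (- int m)) / (2 * g powi (- int n)) < g powi (j + 1)"
        using g1(2,3)[of g] that by (simp_all add: I_def l_def k_def)
    qed
  qed
qed

end
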